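(* There is a fixed constant $\varepsilon_0>0$ such that the following holds. Suppose a streaming algorithm $\mathcal{A}$ solves the $\mathsf{AQ}(\varepsilon,\delta,n,U)$ problem in strict turnstile streams for some $\varepsilon\in(0,\varepsilon_0)$ and $\delta<1/10$. Then $\mathcal{A}$ must use at least $$\Omega\!\left(\varepsilon^{-1}\,\log(\varepsilon n)\,\log\!\left(\frac{\varepsilon U}{\log(\varepsilon n)}\right)\right)$$ bits of memory.
   Context: In a strict turnstile stream over $[U]=\{1,\dots,U\}$, a vector $x$ starts at $0$ and receives updates $x_u\leftarrow x_u+\Delta$ ($\Delta$ may be negative; insertions and deletions of items), with $x_u\ge0$ for all $u$ at all times. Write $\mathrm{rank}(u)=\sum_{v\le u}x_v$. Approximate quantile problem $\mathsf{AQ}(\varepsilon,\delta,n,U)$: with $N=\lceil\|x\|_1\rceil$ the size of the database $x$ at the time of the query, each query $q\in[N]$ must be answered by an index $u\in[U]$ with $\mathrm{rank}(u)\ge q-\varepsilon N$ and $\mathrm{rank}(u-1)\le q+\varepsilon N$, with probability at least $1-\delta$ (for each query individually, over the randomness of the algorithm). The parameter $n$ is the database size the algorithm must be able to handle (streams in which the database size is at most $n$). The constant hidden in $\Omega(\cdot)$ is absolute. *)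

theory Defs
  imports "HOL-Probability.Probability"
begin

text \<open>
  A stream is a list of updates \<open>(u, \<Delta>)\<close>, in order of arrival.  Updates are integral (insertions and
  deletions of items).  With fractional updates the quantile problem below could not be solved at
  all: for total weight \<open>1/100\<close> the size is \<open>\<lceil>1/100\<rceil> = 1\<close>, and no index has rank at
  least \<open>1 - \<epsilon>\<close>.
\<close>

type_synonym stream = "(nat \<times> int) list"

definition freq :: "stream \<Rightarrow> nat \<Rightarrow> int" where
  "freq \<sigma> u = (\<Sum>(v, \<Delta>)\<leftarrow>\<sigma>. if v = u then \<Delta> else 0)"

definition rank :: "stream \<Rightarrow> nat \<Rightarrow> int" where
  "rank \<sigma> u = (\<Sum>v = 1..u. freq \<sigma> v)"

text \<open>
  The size \<open>N = \<lceil>\<parallel>x\<parallel>\<^sub>1\<rceil>\<close> of the database; the ceiling is redundant for integral \<open>x\<close>.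
\<close>

definition db_size :: "nat \<Rightarrow> stream \<Rightarrow> nat" where
  "db_size U \<sigma> = nat (\<Sum>u = 1..U. \<bar>freq \<sigma> u\<bar>)"

text \<open>
  Both nonnegativity and the size bound \<open>n\<close> are required at all times, not just at the end.
\<close>

definition strict_turnstile :: "nat \<Rightarrow> nat \<Rightarrow> stream \<Rightarrow> bool" where
  "strict_turnstile n U \<sigma> \<longleftrightarrow>
     (\<forall>(u, \<Delta>)\<in>set \<sigma>. u \<in> {1..U}) \<and>
     (\<forall>t\<le>length \<sigma>. (\<forall>u\<in>{1..U}. freq (take t \<sigma>) u \<ge> 0) \<and> db_size U (take t \<sigma>) \<le> n)"

text \<open>
  A randomized streaming algorithm whose memory content is a bit string.  Every operation may toss
  fresh coins, and may moreover consult a random seed that is drawn once and not charged as memory.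
  Algorithms that have to store all the randomness they reuse are those with a constant seed; the
  seed type \<^typ>\<open>nat\<close> is no restriction, as a discrete distribution has countable support.
\<close>

record stream_alg =
  seed :: "nat pmf"
  init :: "nat \<Rightarrow> bool list pmf"
  step :: "nat \<Rightarrow> bool list \<Rightarrow> nat \<times> int \<Rightarrow> bool list pmf"
  answer :: "nat \<Rightarrow> bool list \<Rightarrow> nat \<Rightarrow> nat pmf"

definition run :: "stream_alg \<Rightarrow> nat \<Rightarrow> stream \<Rightarrow> bool list pmf" where
  "run A r \<sigma> = foldl (\<lambda>p a. bind_pmf p (\<lambda>s. step A r s a)) (init A r) \<sigma>"

definition query_output :: "stream_alg \<Rightarrow> stream \<Rightarrow> nat \<Rightarrow> nat pmf" where
  "query_output A \<sigma> q =
     bind_pmf (seed A) (\<lambda>r. bind_pmf (run A r \<sigma>) (\<lambda>s. answer A r s q))"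

definition memory_at_most :: "stream_alg \<Rightarrow> nat \<Rightarrow> nat \<Rightarrow> nat \<Rightarrow> bool" where
  "memory_at_most A n U m \<longleftrightarrow>
     (\<forall>\<sigma>. strict_turnstile n U \<sigma> \<longrightarrow>
       (\<forall>r\<in>set_pmf (seed A). \<forall>s\<in>set_pmf (run A r \<sigma>). length s \<le> m))"

definition quantile_ok :: "real \<Rightarrow> nat \<Rightarrow> stream \<Rightarrow> nat \<Rightarrow> nat \<Rightarrow> bool" where
  "quantile_ok \<epsilon> U \<sigma> q u \<longleftrightarrow>
     u \<in> {1..U} \<and>
     real_of_int (rank \<sigma> u) \<ge> real q - \<epsilon> * real (db_size U \<sigma>) \<and>
     real_of_int (rank \<sigma> (u - 1)) \<le> real q + \<epsilon> * real (db_size U \<sigma>)"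

text \<open>
  Every prefix of an admissible stream is admissible, so querying at the end of each stream covers
  queries at all times.
\<close>

definition solves_AQ :: "stream_alg \<Rightarrow> real \<Rightarrow> real \<Rightarrow> nat \<Rightarrow> nat \<Rightarrow> bool" where
  "solves_AQ A \<epsilon> \<delta> n U \<longleftrightarrow>
     (\<forall>\<sigma>. strict_turnstile n U \<sigma> \<longrightarrow>
       (\<forall>q\<in>{1..db_size U \<sigma>}.
         measure_pmf.prob (query_output A \<sigma> q) {u. quantile_ok \<epsilon> U \<sigma> q u} \<ge> 1 - \<delta>))"

end

theory Submission imports Defs begin

text \<open>
  Augmented indexing.  A message of \<open>K\<close> letters from \<open>{..<B}\<close> is stored as \<open>K\<close> items, one in each of \<open>K\<close>
  chunks of the universe, with weights that double after every \<open>k \<approx> 1 / (4 * \<epsilon>)\<close> items; the size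
  bound leaves room for about \<open>log 2 (\<epsilon> * n)\<close> such levels.  From the memory state, somebody who knows
  all letters after position \<open>t\<close> deletes the corresponding items.  The weight of item \<open>t\<close> is then more
  than twice the permitted rank error, and a single query returns its position with probability at
  least 9/10.

  For a fixed state, let \<open>p\<^sub>t\<close> be the probability of guessing letter \<open>t\<close> in this way.  The average of
  \<open>\<Prod>t. 1 + B * p\<^sub>t\<close> over all messages is at most \<open>2 ^ K\<close>, while the logarithm of this product is at least
  \<open>(\<Sum>t. p\<^sub>t) * ln (1 + B)\<close> by concavity.  Summing over the fewer than \<open>2 ^ (m + 1)\<close> states gives
  \<open>9 / 10 * K * ln (1 + B) \<le> ln ((2 ^ (m + 1) - 1) * 2 ^ K)\<close>, hence a bound of order \<open>K * log 2 B\<close>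
  on \<open>m\<close>, including the case \<open>m = 0\<close>.
\<close>

section \<open>Augmented indexing by a potential function\<close>

lemma sum_list_length_Suc:
  fixes f :: "'a list \<Rightarrow> 'b::comm_monoid_add"
  shows "(\<Sum>x | set x \<subseteq> A \<and> length x = Suc k. f x) =
    (\<Sum>ys | set ys \<subseteq> A \<and> length ys = k. \<Sum>v\<in>A. f (v # ys))"
proof -
  have "bij_betw (\<lambda>(ys, v). v # ys) ({ys. set ys \<subseteq> A \<and> length ys = k} \<times> A)
      {x. set x \<subseteq> A \<and> length x = Suc k}"
    by (rule bij_betwI[where g = "\<lambda>x. (tl x, hd x)"]) (auto simp: length_Suc_conv)
  then show ?thesis
    by (subst sum.reindex_bij_betw[symmetric]) (auto simp: sum.cartesian_product case_prod_unfold)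
qed

text \<open>Peel off the first letter: it is guessed from the tail \<open>ys\<close> alone and the
  other factors do not involve it, so summing over its values contributes at most
  \<open>B + l\<close>.\<close>

lemma sum_potential_le:
  fixes D :: "nat list \<Rightarrow> nat \<Rightarrow> real"
  assumes nonneg: "\<And>ys v. 0 \<le> D ys v"
    and sub: "\<And>ys. length ys < K \<Longrightarrow> (\<Sum>v<B. D ys v) \<le> 1"
    and l: "0 \<le> l"
  shows "(\<Sum>x | set x \<subseteq> {..<B} \<and> length x = K.
      \<Prod>t<K. 1 + l * D (drop (Suc t) x) (x ! t)) \<le> (real B + l) ^ K"
  using sub
proof (induction K)
  case 0
  have "{x. set x \<subseteq> {..<B} \<and> x = []} = {[]}" by auto
  then show ?case by simp
next
  case (Suc K)
  let ?P = "\<lambda>ys. \<Prod>t<K. 1 + l * D (drop (Suc t) ys) (ys ! t)"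
  have P: "0 \<le> ?P ys" for ys by (intro prod_nonneg) (simp add: nonneg l)
  have "(\<Sum>x | set x \<subseteq> {..<B} \<and> length x = Suc K.
      \<Prod>t<Suc K. 1 + l * D (drop (Suc t) x) (x ! t))
    = (\<Sum>ys | set ys \<subseteq> {..<B} \<and> length ys = K. (\<Sum>v<B. 1 + l * D ys v) * ?P ys)"
    by (simp add: sum_list_length_Suc prod.lessThan_Suc_shift sum_distrib_right del: prod.lessThan_Suc)
  also have "\<dots> \<le> (\<Sum>ys | set ys \<subseteq> {..<B} \<and> length ys = K. (real B + l) * ?P ys)"
  proof (intro sum_mono mult_right_mono P)
    fix ys assume "ys \<in> {ys. set ys \<subseteq> {..<B} \<and> length ys = K}"
    then have "(\<Sum>v<B. D ys v) \<le> 1" using Suc.prems by auto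
    then show "(\<Sum>v<B. 1 + l * D ys v) \<le> real B + l"
      using l by (simp add: sum.distrib flip: sum_distrib_left) (simp add: mult_left_le)
  qed
  also have "\<dots> = (real B + l) * (\<Sum>ys | set ys \<subseteq> {..<B} \<and> length ys = K. ?P ys)"
    by (simp add: sum_distrib_left)
  also have "\<dots> \<le> (real B + l) * (real B + l) ^ K"
    using Suc l by (intro mult_left_mono) auto
  finally show ?case by simp
qed

lemma ln_one_plus_mult_ge:
  fixes l p :: real
  assumes "0 \<le> l" "0 \<le> p" "p \<le> 1"
  shows "p * ln (1 + l) \<le> ln (1 + l * p)"
proof -
  have "(1 - p) * ln 1 + p * ln (1 + l) \<le> ln ((1 - p) *\<^sub>R 1 + p *\<^sub>R (1 + l))"
    using assms by (intro concave_onD[OF ln_concave]) auto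
  then show ?thesis by (simp add: algebra_simps)
qed

lemma ln_le_tangent:
  fixes y z :: real
  assumes "0 < y" "0 < z"
  shows "ln y \<le> y / z + ln z - 1"
  using ln_le_minus_one[of "y / z"] assms by (simp add: ln_div)

text \<open>
  \<open>W x s\<close> is the probability that message \<open>x\<close> is stored as state \<open>s\<close>, and \<open>D s ys v\<close> the probability
  that a decoder who holds \<open>s\<close> and knows the letters \<open>ys\<close> behind a position guesses \<open>v\<close> there.
  Replacing \<open>ln\<close> by its tangent at \<open>Z\<close> takes the place of Jensen's inequality.
\<close>

lemma augmented_indexing:
  fixes W :: "nat list \<Rightarrow> 's \<Rightarrow> real" and D :: "'s \<Rightarrow> nat list \<Rightarrow> nat \<Rightarrow> real"
  assumes S: "finite S" "S \<noteq> {}" and B: "0 < B"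
    and W: "\<And>x s. 0 \<le> W x s"
    and W1: "\<And>x. set x \<subseteq> {..<B} \<Longrightarrow> length x = K \<Longrightarrow> (\<Sum>s\<in>S. W x s) = 1"
    and D: "\<And>s ys v. 0 \<le> D s ys v"
    and D1: "\<And>s ys. length ys < K \<Longrightarrow> (\<Sum>v<B. D s ys v) \<le> 1"
  shows "(\<Sum>x | set x \<subseteq> {..<B} \<and> length x = K.
      \<Sum>t<K. \<Sum>s\<in>S. W x s * D s (drop (Suc t) x) (x ! t)) * ln (1 + real B)
    \<le> real B ^ K * ln (real (card S) * 2 ^ K)"
proof -
  let ?X = "{x. set x \<subseteq> {..<B} \<and> length x = K}"
  define p where "p x s t = D s (drop (Suc t) x) (x ! t)" for x s t
  define F where "F s x = (\<Prod>t<K. 1 + real B * p x s t)" for s x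
  \<comment> \<open>\<open>Z\<close> bounds the average over messages of the sum of
    \<open>F s x\<close> over all states, so the tangent term averages to at most 1 and cancels the
    \<open>- 1\<close>.\<close>
  define Z where "Z = real (card S) * 2 ^ K"
  have cS: "card S > 0" using S by (simp add: card_gt_0_iff)
  have Z: "Z > 0" using cS by (simp add: Z_def)
  have pos: "1 + real B * p x s t > 0" for x s t
    unfolding p_def by (intro add_pos_nonneg mult_nonneg_nonneg D) auto
  have F: "F s x > 0" for s x
    unfolding F_def by (intro prod_pos pos)
  have W_le: "W x s \<le> 1" if "x \<in> ?X" "s \<in> S" for x s
    using member_le_sum[of s S "W x"] W W1[of x] S that by auto
  have lnF: "(\<Sum>t<K. p x s t) * ln (1 + real B) \<le> F s x / Z + ln Z - 1" if x: "x \<in> ?X" for x s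
  proof -
    have "p x s t \<le> 1" if t: "t < K" for t
    proof -
      have "x ! t \<in> set x" using x t by auto
      then have "x ! t \<in> {..<B}" using x by auto
      then have "p x s t \<le> (\<Sum>v<B. D s (drop (Suc t) x) v)"
        unfolding p_def by (intro member_le_sum) (auto simp: D)
      also have "\<dots> \<le> 1" using x t by (intro D1) auto
      finally show ?thesis .
    qed
    then have "(\<Sum>t<K. p x s t * ln (1 + real B)) \<le> (\<Sum>t<K. ln (1 + real B * p x s t))"
      by (intro sum_mono ln_one_plus_mult_ge) (auto simp: p_def D)
    also have "\<dots> = ln (F s x)"
      unfolding F_def using pos by (intro ln_prod[symmetric]) (auto simp: less_imp_neq[symmetric])
    also have "\<dots> \<le> F s x / Z + ln Z - 1"
      by (rule ln_le_tangent[OF F Z])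
    finally show ?thesis by (simp add: sum_distrib_right)
  qed
  \<comment> \<open>Raising each weight to 1 counts every state in full, which brings in
    \<open>card S\<close>. The potential bound then applies with \<open>l = B\<close>.\<close>
  have "(\<Sum>x\<in>?X. (\<Sum>s\<in>S. W x s * F s x) / Z) \<le> (\<Sum>x\<in>?X. (\<Sum>s\<in>S. F s x) / Z)"
    using Z F W W_le by (intro sum_mono divide_right_mono) (auto simp: less_imp_le mult_left_le_one_le)
  also have "\<dots> = (\<Sum>s\<in>S. \<Sum>x\<in>?X. F s x) / Z"
    by (subst sum.swap) (simp add: sum_divide_distrib)
  also have "\<dots> \<le> (\<Sum>s\<in>S. (real B + real B) ^ K) / Z"
    unfolding F_def p_def using Z by (intro divide_right_mono sum_mono sum_potential_le D D1) auto
  also have "\<dots> = real B ^ K"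
    unfolding mult_2[symmetric] power_mult_distrib using cS by (simp add: Z_def)
  finally have total: "(\<Sum>x\<in>?X. (\<Sum>s\<in>S. W x s * F s x) / Z) \<le> real B ^ K" .
  have "(\<Sum>x\<in>?X. \<Sum>t<K. \<Sum>s\<in>S. W x s * p x s t) * ln (1 + real B)
      = (\<Sum>x\<in>?X. \<Sum>s\<in>S. W x s * ((\<Sum>t<K. p x s t) * ln (1 + real B)))"
    by (subst sum.swap[of _ S]) (simp add: sum_distrib_right sum_distrib_left mult.assoc)
  also have "\<dots> \<le> (\<Sum>x\<in>?X. \<Sum>s\<in>S. W x s * (F s x / Z + ln Z - 1))"
    by (intro sum_mono mult_left_mono lnF W)
  also have "\<dots> = (\<Sum>x\<in>?X. (\<Sum>s\<in>S. W x s * F s x) / Z) + (\<Sum>x\<in>?X. (\<Sum>s\<in>S. W x s) * (ln Z - 1))"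
    by (simp add: sum.distrib[symmetric] sum_distrib_left sum_divide_distrib algebra_simps
        sum_subtractf)
  also have "(\<Sum>x\<in>?X. (\<Sum>s\<in>S. W x s) * (ln Z - 1)) = real B ^ K * (ln Z - 1)"
    by (simp add: W1 card_lists_length_eq)
  finally show ?thesis
    using total unfolding p_def Z_def right_diff_distrib by linarith
qed

section \<open>Frequencies, ranks and deletion of items\<close>

text \<open>Reversing the order makes every partial deletion retrace an earlier stage of the stream,
  so admissibility is inherited whatever the signs.\<close>

definition undo :: "stream \<Rightarrow> stream" where
  "undo \<tau> = rev (map (\<lambda>(u, d). (u, - d)) \<tau>)"

lemma freq_append [simp]: "freq (\<sigma> @ \<tau>) u = freq \<sigma> u + freq \<tau> u"
  by (simp add: freq_def)

lemma freq_Nil [simp]: "freq [] u = 0"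
  by (simp add: freq_def)

lemma freq_Cons [simp]: "freq ((v, d) # \<tau>) u = (if v = u then d else 0) + freq \<tau> u"
  by (simp add: freq_def)

lemma undo_append [simp]: "undo (\<sigma> @ \<tau>) = undo \<tau> @ undo \<sigma>"
  by (simp add: undo_def)

lemma length_undo [simp]: "length (undo \<tau>) = length \<tau>"
  by (simp add: undo_def)

lemma freq_undo [simp]: "freq (undo \<tau>) u = - freq \<tau> u"
  by (induction \<tau>) (auto simp: undo_def)

lemma db_size_cong: "(\<And>u. freq \<sigma> u = freq \<tau> u) \<Longrightarrow> db_size U \<sigma> = db_size U \<tau>"
  by (simp add: db_size_def)

lemma rank_cong: "(\<And>u. freq \<sigma> u = freq \<tau> u) \<Longrightarrow> rank \<sigma> u = rank \<tau> u"
  by (simp add: rank_def)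

lemma take_append_undo:
  "\<exists>s\<le>length (\<sigma> @ \<tau>). \<forall>u. freq (take t (\<sigma> @ \<tau> @ undo \<tau>)) u = freq (take s (\<sigma> @ \<tau>)) u"
proof (cases "t \<le> length (\<sigma> @ \<tau>)")
  case True
  then show ?thesis by (intro exI[of _ t]) simp
next
  case False
  \<comment> \<open>The number of updates of \<open>\<tau>\<close> still in force; truncated
    subtraction yields 0 once \<open>t\<close> passes the end of the stream.\<close>
  define j where "j = length \<tau> - (t - length (\<sigma> @ \<tau>))"
  have "undo \<tau> = undo (drop j \<tau>) @ undo (take j \<tau>)"
    by (simp flip: undo_append)
  moreover have "t - length (\<sigma> @ \<tau>) = length \<tau> - j \<or> j = 0 \<and> length \<tau> \<le> t - length (\<sigma> @ \<tau>)"
    by (auto simp: j_def)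
  ultimately have "take (t - length (\<sigma> @ \<tau>)) (undo \<tau>) = undo (drop j \<tau>)"
    by auto
  moreover have "take t (\<sigma> @ \<tau> @ undo \<tau>) = \<sigma> @ \<tau> @ take (t - length (\<sigma> @ \<tau>)) (undo \<tau>)"
    using False by simp
  ultimately have eq: "take t (\<sigma> @ \<tau> @ undo \<tau>) = \<sigma> @ take j \<tau> @ drop j \<tau> @ undo (drop j \<tau>)"
    by simp
  have "freq (take t (\<sigma> @ \<tau> @ undo \<tau>)) u = freq (take (length \<sigma> + j) (\<sigma> @ \<tau>)) u" for u
    unfolding eq by simp
  then show ?thesis
    by (intro exI[of _ "length \<sigma> + j"]) (auto simp: j_def)
qed

text \<open>Legitimises the decoder's deletions, as correctness is guaranteed on admissible streams
  only.\<close>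

lemma strict_turnstile_undo:
  assumes "strict_turnstile n U (\<sigma> @ \<tau>)"
  shows "strict_turnstile n U (\<sigma> @ \<tau> @ undo \<tau>)"
  unfolding strict_turnstile_def
proof (intro conjI allI impI)
  show "\<forall>(u, d)\<in>set (\<sigma> @ \<tau> @ undo \<tau>). u \<in> {1..U}"
    using assms by (fastforce simp: strict_turnstile_def undo_def)
next
  fix t
  obtain s where s: "s \<le> length (\<sigma> @ \<tau>)"
    and eq: "\<And>u. freq (take t (\<sigma> @ \<tau> @ undo \<tau>)) u = freq (take s (\<sigma> @ \<tau>)) u"
    using take_append_undo[of \<sigma> \<tau> t] by auto
  have ok: "(\<forall>u\<in>{1..U}. freq (take s (\<sigma> @ \<tau>)) u \<ge> 0) \<and> db_size U (take s (\<sigma> @ \<tau>)) \<le> n"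
    using assms s unfolding strict_turnstile_def by blast
  then show "\<forall>u\<in>{1..U}. freq (take t (\<sigma> @ \<tau> @ undo \<tau>)) u \<ge> 0"
    unfolding eq by blast
  show "db_size U (take t (\<sigma> @ \<tau> @ undo \<tau>)) \<le> n"
    using ok db_size_cong[of "take t (\<sigma> @ \<tau> @ undo \<tau>)", OF eq] by simp
qed

lemma rank_append [simp]: "rank (\<sigma> @ \<tau>) u = rank \<sigma> u + rank \<tau> u"
  by (simp add: rank_def sum.distrib)

lemma rank_Nil [simp]: "rank [] u = 0"
  by (simp add: rank_def)

lemma rank_Cons [simp]: "rank ((v, d) # \<tau>) u = (if 1 \<le> v \<and> v \<le> u then d else 0) + rank \<tau> u"
  by (simp add: rank_def sum.distrib)

lemma freq_nonneg: "(\<And>v d. (v, d) \<in> set \<sigma> \<Longrightarrow> 0 \<le> d) \<Longrightarrow> 0 \<le> freq \<sigma> u"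
  by (induction \<sigma>) (fastforce)+

lemma db_size_eq_rank:
  assumes "\<And>u. 0 \<le> freq \<sigma> u"
  shows "db_size U \<sigma> = nat (rank \<sigma> U)"
  using assms by (simp add: db_size_def rank_def)

lemma rank_le_sum_list:
  "(\<And>v d. (v, d) \<in> set \<sigma> \<Longrightarrow> 0 \<le> d) \<Longrightarrow> rank \<sigma> u \<le> sum_list (map snd \<sigma>)"
proof (induction \<sigma>)
  case (Cons a \<sigma>)
  then show ?case by (cases a) (fastforce)
qed simp

lemma strict_turnstile_insertions:
  assumes ins: "\<And>v d. (v, d) \<in> set \<sigma> \<Longrightarrow> v \<in> {1..U} \<and> 0 \<le> d"
    and n: "sum_list (map snd \<sigma>) \<le> int n"
  shows "strict_turnstile n U \<sigma>"
  unfolding strict_turnstile_def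
proof (intro conjI allI impI ballI)
  fix t
  have nonneg: "0 \<le> d" if "(v, d) \<in> set (take t \<sigma>)" for v d
    using ins set_take_subset[of t \<sigma>] that by blast
  show freq: "0 \<le> freq (take t \<sigma>) u" for u
    using nonneg by (rule freq_nonneg)
  have "sum_list (map snd \<sigma>) = sum_list (map snd (take t \<sigma>)) + sum_list (map snd (drop t \<sigma>))"
    by (simp flip: sum_list_append map_append)
  moreover have "0 \<le> sum_list (map snd (drop t \<sigma>))"
    using ins set_drop_subset[of t \<sigma>] by (intro sum_list_nonneg) fastforce
  moreover have "rank (take t \<sigma>) U \<le> sum_list (map snd (take t \<sigma>))"
    using nonneg by (rule rank_le_sum_list)
  ultimately have "rank (take t \<sigma>) U \<le> int n"
    using n by simp
  then show "db_size U (take t \<sigma>) \<le> n"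
    by (simp add: db_size_eq_rank freq)
qed (use ins in auto)

section \<open>Messages as streams\<close>

text \<open>
  The letter \<open>v < B\<close> at position \<open>t\<close> becomes one item in the chunk \<open>{t * B + 1..(t + 1) * B}\<close> of the
  universe.  Weights are even so that the middle of an item is a legal query.
\<close>

primrec encode :: "nat \<Rightarrow> (nat \<Rightarrow> nat) \<Rightarrow> nat \<Rightarrow> nat list \<Rightarrow> stream" where
  "encode B h i [] = []"
| "encode B h i (v # xs) = (i * B + v + 1, int (2 * h i)) # encode B h (Suc i) xs"

lemma encode_append [simp]:
  "encode B h i (xs @ ys) = encode B h i xs @ encode B h (i + length xs) ys"
  by (induction xs arbitrary: i) auto

lemma encode_bounds:
  assumes "set xs \<subseteq> {..<B}" "(u, d) \<in> set (encode B h i xs)"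
  shows "i * B < u \<and> u \<le> (i + length xs) * B \<and> 0 \<le> d"
  using assms
proof (induction xs arbitrary: i)
  case (Cons v xs)
  then show ?case
    using Cons.IH[of "Suc i"] by (auto simp: algebra_simps)
qed simp

lemma sum_list_encode:
  "sum_list (map snd (encode B h 0 xs)) = int (\<Sum>t<length xs. 2 * h t)"
  by (induction xs rule: rev_induct) auto

lemma rank_above:
  assumes "\<And>v d. (v, d) \<in> set \<sigma> \<Longrightarrow> 1 \<le> v \<and> v \<le> u"
  shows "rank \<sigma> u = sum_list (map snd \<sigma>)"
  using assms
proof (induction \<sigma>)
  case (Cons a \<sigma>)
  then show ?case by (cases a) (fastforce)
qed simp

text \<open>
  The weights before \<open>t\<close> add up to the same value \<open>R\<close> whatever the letters in the lower chunks are,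
  so the query at the middle of \<open>{R..R + 2 * h t}\<close> pins down the position of the last item.
\<close>

lemma quantile_ok_last_item:
  assumes xs: "set xs \<subseteq> {..<B}" and v: "v < B" and U: "Suc (length xs) * B \<le> U"
    and h: "\<epsilon> * (\<Sum>t\<le>length xs. 2 * real (h t)) < real (h (length xs))"
    and ok: "quantile_ok \<epsilon> U (encode B h 0 (xs @ [v])) ((\<Sum>t<length xs. 2 * h t) + h (length xs)) u"
  shows "u = length xs * B + v + 1"
proof -
  let ?\<sigma> = "encode B h 0 xs" and ?\<tau> = "encode B h 0 (xs @ [v])" and ?k = "length xs"
  let ?R = "\<Sum>t<?k. 2 * h t"
  have b: "1 \<le> u' \<and> u' \<le> ?k * B" "0 \<le> d" if "(u', d) \<in> set ?\<sigma>" for u' d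
    using encode_bounds[OF xs that] by auto
  have le: "rank ?\<sigma> u' \<le> ?R" for u'
    using rank_le_sum_list[of ?\<sigma> u'] b by (simp add: sum_list_encode)
  have eq: "rank ?\<sigma> u' = ?R" if "?k * B \<le> u'" for u'
    using rank_above[of ?\<sigma> u'] b that by (fastforce simp: sum_list_encode)
  have rank: "rank ?\<tau> u' = rank ?\<sigma> u' + (if ?k * B + v + 1 \<le> u' then int (2 * h ?k) else 0)" for u'
    by simp
  have freq: "0 \<le> freq ?\<tau> u'" for u'
    using b by (intro freq_nonneg) auto
  have "?k * B + v + 1 \<le> U" using U v by simp
  then have "rank ?\<tau> U = int (?R + 2 * h ?k)" by (simp add: rank eq)
  then have N: "db_size U ?\<tau> = ?R + 2 * h ?k"
    using db_size_eq_rank[OF freq, of U] by (simp only: nat_int)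
  have "{..?k} = insert ?k {..<?k}" by auto
  then have err: "\<epsilon> * real (db_size U ?\<tau>) < real (h ?k)"
    using h unfolding N by (simp add: add.commute)
  \<comment> \<open>The query is \<open>?R + h ?k\<close>, so an error below \<open>h ?k\<close>
    leaves strict bounds: \<open>lo\<close> puts \<open>u\<close> at or after the last item,
    \<open>hi\<close> puts \<open>u - 1\<close> before it.\<close>
  have lo: "real ?R < real_of_int (rank ?\<tau> u)"
    using ok err unfolding quantile_ok_def by simp
  have hi: "real_of_int (rank ?\<tau> (u - 1)) < real ?R + 2 * real (h ?k)"
    using ok err unfolding quantile_ok_def by simp
  have "?k * B + v + 1 \<le> u"
  proof (rule ccontr)
    assume "\<not> ?thesis"
    then have "rank ?\<tau> u \<le> ?R" using le[of u] by (simp add: rank)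
    then show False using lo by linarith
  qed
  moreover have "u - 1 < ?k * B + v + 1"
  proof (rule ccontr)
    assume "\<not> ?thesis"
    then have "rank ?\<tau> (u - 1) = ?R + 2 * h ?k" using eq[of "u - 1"] by (simp add: rank)
    then show False using hi by simp
  qed
  ultimately show ?thesis by simp
qed

section \<open>From memory states to decoding\<close>

text \<open>With the seed fixed, the continuation depends on the past only through the state
  \<open>s\<close>, which is all that the decoder receives from the encoder.\<close>

definition resume :: "stream_alg \<Rightarrow> nat \<Rightarrow> bool list \<Rightarrow> stream \<Rightarrow> bool list pmf" where
  "resume A r s \<tau> = foldl (\<lambda>p a. bind_pmf p (\<lambda>s. step A r s a)) (return_pmf s) \<tau>"

lemma run_append: "run A r (\<sigma> @ \<tau>) = bind_pmf (run A r \<sigma>) (\<lambda>s. resume A r s \<tau>)"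
  unfolding run_def resume_def
  by (induction \<tau> rule: rev_induct) (simp_all add: bind_return_pmf' bind_assoc_pmf)

lemma sum_pmf_inj_le_1:
  assumes "finite I" "inj_on f I"
  shows "(\<Sum>i\<in>I. pmf p (f i)) \<le> 1"
proof -
  have "(\<Sum>i\<in>I. pmf p (f i)) = measure_pmf.prob p (f ` I)"
    using assms by (simp add: measure_measure_pmf_finite sum.reindex)
  then show ?thesis by simp
qed

lemma sum_pmf_bind_le:
  assumes "\<And>r. r \<in> set_pmf p \<Longrightarrow> (\<Sum>i\<in>I. pmf (f i r) (y i)) \<le> C" and "finite I"
  shows "(\<Sum>i\<in>I. pmf (bind_pmf p (f i)) (y i)) \<le> C"
proof -
  have int: "integrable (measure_pmf p) (\<lambda>r. pmf (f i r) (y i))" for i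
    by (rule measure_pmf.integrable_const_bound[where B = 1]) (auto simp: pmf_le_1)
  have "(\<Sum>i\<in>I. pmf (bind_pmf p (f i)) (y i)) = (\<integral>r. (\<Sum>i\<in>I. pmf (f i r) (y i)) \<partial>measure_pmf p)"
    by (simp add: pmf_bind int)
  also have "\<dots> \<le> C"
    using assms by (intro measure_pmf.integral_le_const) (auto simp: int AE_measure_pmf_iff)
  finally show ?thesis .
qed


text \<open>Correctness holds on average over the seed, whereas states are counted for one seed at a
  time. Summing over all pairs of message and position before averaging reconciles the two.\<close>

lemma memory_lower_bound:
  assumes AQ: "solves_AQ A \<epsilon> \<delta> n U" and \<delta>: "\<delta> \<le> 1 / 10" and mem: "memory_at_most A n U m"
    and B: "0 < B" and U: "K * B \<le> U"
    and h: "\<And>t. t < K \<Longrightarrow> \<epsilon> * (\<Sum>t'\<le>t. 2 * real (h t')) < real (h t)"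
    and h0: "\<And>t. 0 < h t"
    and n: "(\<Sum>t<K. 2 * h t) \<le> n"
  shows "9 / 10 * real K * ln (1 + real B) \<le> ln ((2 ^ (m + 1) - 1) * 2 ^ K)"
proof -
  let ?X = "{x. set x \<subseteq> {..<B} \<and> length x = K}"
  define S where "S = {s :: bool list. length s \<le> m}"
  \<comment> \<open>Once the later items are deleted, this is the midpoint of the rank interval of
    item \<open>t\<close>, whatever the letters are.\<close>
  define q where "q t = (\<Sum>t'<t. 2 * h t') + h t" for t
  define del where "del t ys = undo (encode B h (Suc t) ys)" for t ys
  define out where "out r x t = bind_pmf (run A r (encode B h 0 x @ del t (drop (Suc t) x)))
    (\<lambda>s. answer A r s (q t))" for r x t
  have S: "finite S" "S \<noteq> {}"
    using finite_lists_length_le[of "UNIV :: bool set" m] by (auto simp: S_def intro: exI[of _ "[]"])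
  \<comment> \<open>The exact count matters for \<open>m = 0\<close>: there is one state, and its
    logarithm vanishes.\<close>
  have "card S = (\<Sum>i\<le>m. 2 ^ i)"
    using card_lists_length_le[of "UNIV :: bool set" m] by (simp add: S_def)
  also have "\<dots> = 2 ^ (m + 1) - (1 :: nat)"
    by (induction m) auto
  finally have cardS: "real (card S) = 2 ^ (m + 1) - 1"
    by (simp add: of_nat_diff)
  have lnB: "0 < ln (1 + real B)" using B by simp
  have XE: "x = take t x @ [x ! t] @ drop (Suc t) x" if "x \<in> ?X" "t < K" for x t
    using that by (simp add: id_take_nth_drop)
  have stream: "strict_turnstile n U (encode B h 0 x)" if x: "x \<in> ?X" for x
  proof (rule strict_turnstile_insertions)
    show "v \<in> {1..U} \<and> 0 \<le> d" if "(v, d) \<in> set (encode B h 0 x)" for v d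
      using encode_bounds[of x B v d h 0] that x U by auto
    show "sum_list (map snd (encode B h 0 x)) \<le> int n"
      using x n unfolding sum_list_encode of_nat_le_iff by simp
  qed
  have lower: "9 / 10 \<le> pmf (bind_pmf (seed A) (\<lambda>r. out r x t)) (t * B + x ! t + 1)"
    if x: "x \<in> ?X" and t: "t < K" for x t
  proof -
    let ?\<sigma> = "encode B h 0 (take t x @ [x ! t])" and ?\<tau> = "encode B h (Suc t) (drop (Suc t) x)"
    have len: "length (take t x) = t" using x t by simp
    have split: "encode B h 0 x = ?\<sigma> @ ?\<tau>"
      by (subst XE[OF x t]) (use x t in simp)
    have st: "strict_turnstile n U (encode B h 0 x @ del t (drop (Suc t) x))"
      using strict_turnstile_undo[of n U ?\<sigma> ?\<tau>] stream[OF x]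
      unfolding split del_def append_assoc .
    have freq: "freq (encode B h 0 x @ del t (drop (Suc t) x)) u = freq ?\<sigma> u" for u
      unfolding split del_def by simp
    have nonneg: "0 \<le> d" if "(u, d) \<in> set ?\<sigma>" for u d
      using encode_bounds[of x B u d h 0] that x unfolding split by auto
    have size: "db_size U (encode B h 0 x @ del t (drop (Suc t) x)) = q t + h t"
    proof -
      have "rank ?\<sigma> U = sum_list (map snd ?\<sigma>)"
      proof (rule rank_above)
        fix u d assume "(u, d) \<in> set ?\<sigma>"
        then have "(u, d) \<in> set (encode B h 0 x)" unfolding split set_append by blast
        then show "1 \<le> u \<and> u \<le> U" using stream[OF x] by (fastforce simp: strict_turnstile_def)
      qed
      also have "\<dots> = int (q t + h t)"
        by (subst sum_list_encode) (use x t in \<open>simp add: q_def\<close>)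
      finally show ?thesis
        using db_size_eq_rank[of ?\<sigma> U, OF freq_nonneg[OF nonneg]] db_size_cong[OF freq, where U = U]
        by (simp only: nat_int)
    qed
    have "q t \<in> {1..db_size U (encode B h 0 x @ del t (drop (Suc t) x))}"
      using h0[of t] unfolding size by (simp add: q_def)
    then have "1 - \<delta> \<le> measure_pmf.prob
        (query_output A (encode B h 0 x @ del t (drop (Suc t) x)) (q t))
        {u. quantile_ok \<epsilon> U (encode B h 0 x @ del t (drop (Suc t) x)) (q t) u}"
      using AQ st unfolding solves_AQ_def by blast
    \<comment> \<open>\<open>quantile_ok\<close> depends on frequencies alone, so the later items
      may be dropped together with their deletions, and a single acceptable answer remains.\<close>
    also have "\<dots> \<le> measure_pmf.prob
        (query_output A (encode B h 0 x @ del t (drop (Suc t) x)) (q t)) {t * B + x ! t + 1}"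
    proof (rule measure_pmf.finite_measure_mono; clarsimp)
      fix u assume "quantile_ok \<epsilon> U (encode B h 0 x @ del t (drop (Suc t) x)) (q t) u"
      then have "quantile_ok \<epsilon> U ?\<sigma> (q t) u"
        unfolding quantile_ok_def db_size_cong[OF freq] rank_cong[OF freq] .
      moreover have "Suc t * B \<le> U"
        using U t mult_le_mono1[of "Suc t" K B] by linarith
      moreover have "x ! t < B" using x t by (auto simp: subset_eq)
      moreover have "set (take t x) \<subseteq> {..<B}" using x set_take_subset[of t x] by blast
      ultimately show "u = Suc (t * B + x ! t)"
        using quantile_ok_last_item[of "take t x" B "x ! t" U \<epsilon> h u] h[OF t]
        unfolding len q_def by simp
    qed
    also have "\<dots> = pmf (bind_pmf (seed A) (\<lambda>r. out r x t)) (t * B + x ! t + 1)"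
      by (simp add: query_output_def out_def measure_pmf_single)
    finally show ?thesis using \<delta> by simp
  qed
  have upper: "(\<Sum>(x, t)\<in>?X \<times> {..<K}. pmf (out r x t) (t * B + x ! t + 1))
      \<le> real B ^ K * ln (real (card S) * 2 ^ K) / ln (1 + real B)"
    if r: "r \<in> set_pmf (seed A)" for r
  proof -
    define W where "W x s = pmf (run A r (encode B h 0 x)) s" for x s
    \<comment> \<open>The potential argument passes only the known suffix, so the position is
      recovered from its length.\<close>
    define D where "D s ys v = (let t = K - Suc (length ys) in
      pmf (bind_pmf (resume A r s (del t ys)) (\<lambda>s'. answer A r s' (q t))) (t * B + v + 1))" for s ys v
    have sub: "set_pmf (run A r (encode B h 0 x)) \<subseteq> S" if "x \<in> ?X" for x
      using mem stream[OF that] r by (auto simp: memory_at_most_def S_def)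
    have "pmf (out r x t) (t * B + x ! t + 1) = (\<Sum>s\<in>S. W x s * D s (drop (Suc t) x) (x ! t))"
      if "x \<in> ?X" "t < K" for x t
    proof -
      have t: "K - Suc (length (drop (Suc t) x)) = t" using that by simp
      have "pmf (out r x t) (t * B + x ! t + 1) =
          (\<integral>s. D s (drop (Suc t) x) (x ! t) \<partial>measure_pmf (run A r (encode B h 0 x)))"
        unfolding out_def run_append bind_assoc_pmf D_def t Let_def by (rule pmf_bind)
      also have "\<dots> = (\<Sum>s\<in>S. D s (drop (Suc t) x) (x ! t) * W x s)"
        unfolding W_def using sub[OF that(1)] by (intro integral_measure_pmf_real S) auto
      finally show ?thesis by (simp add: mult.commute)
    qed
    then have "(\<Sum>(x, t)\<in>?X \<times> {..<K}. pmf (out r x t) (t * B + x ! t + 1))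
        = (\<Sum>x\<in>?X. \<Sum>t<K. \<Sum>s\<in>S. W x s * D s (drop (Suc t) x) (x ! t))"
      by (simp add: sum.cartesian_product[symmetric])
    moreover have "\<dots> * ln (1 + real B) \<le> real B ^ K * ln (real (card S) * 2 ^ K)"
    proof (rule augmented_indexing[OF S B])
      show "(\<Sum>s\<in>S. W x s) = 1" if "set x \<subseteq> {..<B}" "length x = K" for x
        unfolding W_def using sub[of x] that S by (intro sum_pmf_eq_1) auto
      \<comment> \<open>Distinct letters occupy distinct elements of the universe.\<close>
      show "(\<Sum>v<B. D s ys v) \<le> 1" for s ys
        unfolding D_def Let_def by (intro sum_pmf_inj_le_1) (auto simp: inj_on_def)
    qed (auto simp: W_def D_def Let_def)
    ultimately show ?thesis using lnB by (simp add: pos_le_divide_eq)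
  qed
  have fin: "finite (?X \<times> {..<K})" by (simp add: finite_lists_length_eq)
  have "real B ^ K * real K * (9 / 10) = (\<Sum>(x, t)\<in>?X \<times> {..<K}. 9 / 10)"
    by (simp add: card_cartesian_product card_lists_length_eq case_prod_unfold)
  also have "\<dots> \<le> (\<Sum>(x, t)\<in>?X \<times> {..<K}. pmf (bind_pmf (seed A) (\<lambda>r. out r x t)) (t * B + x ! t + 1))"
    using lower by (intro sum_mono) auto
  also have "\<dots> \<le> real B ^ K * ln (real (card S) * 2 ^ K) / ln (1 + real B)"
    using sum_pmf_bind_le[where p = "seed A" and I = "?X \<times> {..<K}"
        and f = "\<lambda>(x, t) r. out r x t" and y = "\<lambda>(x, t). t * B + x ! t + 1"] upper fin by (simp add: case_prod_unfold)
  finally have "real B ^ K * (9 / 10 * real K * ln (1 + real B))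
      \<le> real B ^ K * ln (real (card S) * 2 ^ K)"
    using lnB by (simp add: field_simps)
  then show ?thesis using B by (simp add: cardS)
qed

section \<open>Geometric weights and choice of parameters\<close>

lemma sum_power_div:
  "(\<Sum>t<j * k. 2 * 2 ^ (t div k)) = 2 * real k * (2 ^ j - 1)"
proof (induction j)
  case (Suc j)
  show ?case
  proof (cases "k = 0")
    case False
    have "(\<Sum>t<Suc j * k. 2 * 2 ^ (t div k) :: real)
        = (\<Sum>t<j * k. 2 * 2 ^ (t div k)) + (\<Sum>t=j * k..<j * k + k. 2 * 2 ^ (t div k))"
      by (subst sum.union_disjoint[symmetric]) (auto intro: sum.cong simp: ivl_disj_un)
    also have "(\<Sum>t=j * k..<j * k + k. 2 * 2 ^ (t div k) :: real) = (\<Sum>t=j * k..<j * k + k. 2 * 2 ^ j)"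
    proof (intro sum.cong refl)
      fix t assume "t \<in> {j * k..<j * k + k}"
      then have "t div k = j" using False by (intro div_nat_eqI) (auto simp: mult.commute)
      then show "2 * 2 ^ (t div k) = (2 * 2 ^ j :: real)" by simp
    qed
    finally show ?thesis by (simp add: Suc algebra_simps)
  qed simp
qed simp

text \<open>There is room for \<open>J\<close> levels of \<open>k\<close> items; allowing fewer
  items \<open>K\<close> covers universes too small for all of them.\<close>

lemma memory_ge_items:
  assumes AQ: "solves_AQ A \<epsilon> \<delta> n U" and \<delta>: "\<delta> \<le> 1 / 10" and mem: "memory_at_most A n U m"
    and \<epsilon>: "0 < \<epsilon>" "4 * \<epsilon> * real k \<le> 1" and n: "2 * real k * 2 ^ J \<le> real n"
    and K: "0 < K" "K \<le> J * k" and B: "2 \<le> B" and U: "K * B \<le> U"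
  shows "real K * log 2 (real B) / 10 \<le> real m"
proof -
  have k: "0 < k" using K by (cases k) auto
  define h :: "nat \<Rightarrow> nat" where "h t = 2 ^ (t div k)" for t
  have "\<epsilon> * (\<Sum>t'\<le>t. 2 * real (h t')) < real (h t)" for t
  proof -
    define j where "j = t div k"
    \<comment> \<open>Rounding up to the complete levels \<open>0..j\<close> keeps the total weight
      below \<open>4 * k * 2 ^ j\<close>, hence the rank error below \<open>2 ^ j\<close>.\<close>
    have "t < Suc j * k" unfolding j_def using dividend_less_div_times[OF k, of t] by simp
    then have "(\<Sum>t'\<le>t. 2 * real (h t')) \<le> (\<Sum>t'<Suc j * k. 2 * real (h t'))"
      by (intro sum_mono2) auto
    also have "\<dots> < 4 * real k * 2 ^ j"
      using sum_power_div[where j = "Suc j" and k = k] k by (simp add: h_def algebra_simps)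
    finally have "\<epsilon> * (\<Sum>t'\<le>t. 2 * real (h t')) < (4 * \<epsilon> * real k) * 2 ^ j"
      using \<epsilon> by (simp add: mult_ac)
    also have "\<dots> \<le> 1 * 2 ^ j" by (intro mult_right_mono \<epsilon>) simp
    finally show ?thesis by (simp add: h_def j_def)
  qed
  moreover have "(\<Sum>t<K. 2 * h t) \<le> n"
  proof -
    have "(\<Sum>t<K. 2 * h t) \<le> (\<Sum>t<J * k. 2 * h t)"
      using K by (intro sum_mono2) auto
    moreover have "real (\<Sum>t<J * k. 2 * h t) = 2 * real k * (2 ^ J - 1)"
      using sum_power_div[where j = J and k = k] by (simp add: h_def)
    moreover have "2 * real k * (2 ^ J - 1) \<le> real n" using n by (simp add: algebra_simps)
    ultimately show ?thesis by linarith
  qed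
  ultimately have main: "9 / 10 * real K * ln (1 + real B) \<le> ln ((2 ^ (m + 1) - 1) * 2 ^ K)"
    using memory_lower_bound[OF AQ \<delta> mem _ U, of h] B by (simp add: h_def)
  have pos: "(0::real) < 2 ^ (m + 1) - 1"
    using one_less_power[of "2 :: real" "m + 1"] by simp
  \<comment> \<open>From 8 < 9, \<open>ln 3\<close> is at least \<open>3 / 2 * ln 2\<close>. Since
    \<open>7 / 10 * (3 / 2) > 1\<close>, the loss of \<open>ln 2\<close> per position is absorbed
    and a fifth of \<open>ln B\<close> is left.\<close>
  have "3 * ln 2 = ln (8 :: real)" using ln_realpow[of 2 3] by simp
  also have "\<dots> \<le> ln (3 ^ 2)" by simp
  also have "\<dots> = 2 * ln 3" using ln_realpow[of 3 2] by simp
  also have "ln 3 \<le> ln (1 + real B)" using B by simp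
  finally have ln2: "3 / 2 * ln 2 \<le> ln (1 + real B)" by simp
  have "ln (real B) / 5 \<le> ln (1 + real B) / 5" using B by simp
  then have "ln (real B) / 5 \<le> 9 / 10 * ln (1 + real B) - ln 2"
    using ln2 ln_gt_zero[of "2 :: real"] by linarith
  then have "real K * (ln (real B) / 5) \<le> real K * (9 / 10 * ln (1 + real B) - ln 2)"
    by (intro mult_left_mono) auto
  also have "\<dots> \<le> ln (2 ^ (m + 1) - 1)"
  proof -
    have "ln ((2 ^ (m + 1) - 1) * 2 ^ K) = ln (2 ^ (m + 1) - 1) + real K * ln 2"
      using pos by (subst ln_mult) (simp_all add: ln_realpow)
    then show ?thesis
      using main unfolding right_diff_distrib by linarith
  qed
  finally have bound: "real K * (ln (real B) / 5) \<le> ln (2 ^ (m + 1) - 1)" .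
  \<comment> \<open>For \<open>m = 0\<close> the right side of \<open>bound\<close> would be
    \<open>ln 1\<close>. So \<open>m + 1 \<le> 2 * m\<close>, at the cost of a factor 2.\<close>
  have "0 < real K * (ln (real B) / 5)" using K B by simp
  then have "m \<noteq> 0" using bound by (intro notI) simp
  have "ln (2 ^ (m + 1) - 1) \<le> ln ((2 :: real) ^ (m + 1))" using pos by (subst ln_le_cancel_iff) auto
  also have "\<dots> = real (m + 1) * ln 2" by (rule ln_realpow)
  also have "\<dots> \<le> (2 * real m) * ln 2"
    using \<open>m \<noteq> 0\<close> by (intro mult_right_mono) auto
  finally show ?thesis
    using bound by (simp add: log_def field_simps)
qed

text \<open>Controls the logarithms of \<open>1 / L\<close> and \<open>y\<close> in the regimes with
  \<open>L < 1\<close>.\<close>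

lemma log2_le_twice:
  assumes "0 < (z :: real)"
  shows "log 2 z \<le> 2 * z"
proof -
  have "ln z \<le> z" using ln_le_minus_one[OF assms] by simp
  moreover have "z \<le> 2 * z * ln 2" using ln2_ge_two_thirds assms by simp
  ultimately show ?thesis by (simp add: log_def field_simps)
qed

text \<open>A universe with one element needs no memory although the bound can be positive there,
  hence \<open>U \<ge> 2\<close>. The regimes with \<open>L < 1\<close> determine the constant
  \<open>1 / 160\<close>.\<close>

theorem theorem5p1:
  "\<exists>\<epsilon>\<^sub>0>0. \<exists>c>0. \<forall>(\<epsilon>::real) (\<delta>::real) (n::nat) (U::nat) (A::stream_alg) (m::nat).
     0 < \<epsilon> \<and> \<epsilon> < \<epsilon>\<^sub>0 \<and> \<delta> < 1 / 10 \<and>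
     \<epsilon> * real n > 1 \<and> U \<ge> 2 \<and>
     solves_AQ A \<epsilon> \<delta> n U \<and> memory_at_most A n U m \<longrightarrow>
     real m \<ge> c * (1 / \<epsilon> * log 2 (\<epsilon> * real n) * log 2 (\<epsilon> * real U / log 2 (\<epsilon> * real n)))"
proof (rule exI[of _ "1 / 4"], intro conjI, simp, rule exI[of _ "1 / 160"], intro conjI, simp,
    intro allI impI, elim conjE)
  fix \<epsilon> \<delta> :: real and n U :: nat and A :: stream_alg and m :: nat
  assume \<epsilon>: "0 < \<epsilon>" "\<epsilon> < 1 / 4" and \<delta>: "\<delta> < 1 / 10" and n: "\<epsilon> * real n > 1" and U: "U \<ge> 2"
    and AQ: "solves_AQ A \<epsilon> \<delta> n U" and mem: "memory_at_most A n U m"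
  define L where "L = log 2 (\<epsilon> * real n)"
  define y where "y = \<epsilon> * real U / L"
  have L: "0 < L" using n by (simp add: L_def)
  have y: "0 < y" using U \<epsilon> L by (simp add: y_def)
  \<comment> \<open>The largest \<open>k\<close> with \<open>4 * \<epsilon> * k \<le> 1\<close>; as
    \<open>\<epsilon> < 1 / 4\<close>, it is positive and rounding loses at most a factor 2.\<close>
  define k where "k = nat \<lfloor>1 / (4 * \<epsilon>)\<rfloor>"
  \<comment> \<open>At least one level even for \<open>L < 1\<close>, and still
    \<open>2 ^ J \<le> 2 * \<epsilon> * n\<close>, so that all levels fit into size
    \<open>n\<close>.\<close>
  define J where "J = nat \<lfloor>1 + L\<rfloor>"
  have "1 < 1 / (4 * \<epsilon>)" using \<epsilon> by simp
  then have k: "1 \<le> k" "real k \<le> 1 / (4 * \<epsilon>)" "1 / (4 * \<epsilon>) < real k + 1"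
    unfolding k_def by linarith+
  then have "1 / (4 * \<epsilon>) \<le> 2 * real k" by linarith
  then have k_ge: "1 / (8 * \<epsilon>) \<le> real k" using \<epsilon> by (simp add: field_simps)
  have J: "1 \<le> J" "L \<le> real J" "real J \<le> 1 + L" using L unfolding J_def by linarith+
  have k\<epsilon>: "4 * \<epsilon> * real k \<le> 1" using k \<epsilon> by (simp add: field_simps)
  have "2 ^ J = 2 powr real J" by (simp add: powr_realpow)
  also have "\<dots> \<le> 2 powr (1 + L)" using J by simp
  also have "\<dots> = 2 * (\<epsilon> * real n)"
    using n by (simp add: powr_add L_def)
  finally have "2 * real k * 2 ^ J \<le> 2 * (1 / (4 * \<epsilon>)) * (2 * (\<epsilon> * real n))"
    using k \<epsilon> by (intro mult_mono) auto
  then have kJ: "2 * real k * 2 ^ J \<le> real n" using \<epsilon> by simp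
  note mem_ge = memory_ge_items[OF AQ less_imp_le[OF \<delta>] mem \<epsilon>(1) k\<epsilon> kJ]
  have "L * log 2 y / (160 * \<epsilon>) \<le> real m"
  proof -
    consider "y \<le> 1" | "1 < y" "1 \<le> L" | "1 < y" "L < 1" "1 \<le> \<epsilon> * real U"
      | "1 < y" "L < 1" "\<epsilon> * real U < 1" by linarith
    then show ?thesis
    proof cases
      case 1
      then have "L * log 2 y / (160 * \<epsilon>) \<le> 0"
        using L y \<epsilon> by (simp add: divide_nonpos_pos mult_nonneg_nonpos)
      then show ?thesis by simp
    next
      case 2
      \<comment> \<open>As \<open>1 \<le> L\<close>, \<open>J \<le> 2 * L\<close>. Chunks then have
        more than \<open>2 * y - 1 > y\<close> elements.\<close>
      define K where "K = J * k"
      define B where "B = U div K"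
      have K: "0 < K" using J k by (simp add: K_def)
      have "real K \<le> (2 * L) * (1 / (4 * \<epsilon>))"
        unfolding K_def of_nat_mult using J k 2 by (intro mult_mono) auto
      then have "real K * (2 * y) \<le> (2 * L) * (1 / (4 * \<epsilon>)) * (2 * y)"
        using y by (intro mult_right_mono) auto
      also have "\<dots> = real U" using L \<epsilon> by (simp add: y_def)
      finally have "2 * y \<le> real U / real K" using K by (simp add: field_simps)
      moreover have "real U / real K < real B + 1"
        unfolding B_def using floor_divide_of_nat_eq[of U K, where ?'a = real]
        by linarith
      ultimately have B: "y \<le> real B" "2 \<le> B" using 2 by linarith+
      have KL: "L * (1 / (8 * \<epsilon>)) \<le> real K"
        unfolding K_def of_nat_mult using J k_ge L \<epsilon> by (intro mult_mono) auto
      have "L * log 2 y / (160 * \<epsilon>) \<le> L * log 2 y / (80 * \<epsilon>)"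
        using L 2 \<epsilon> by (intro divide_left_mono) auto
      also have "\<dots> = L * (1 / (8 * \<epsilon>)) * log 2 y / 10" by simp
      also have "\<dots> \<le> real K * log 2 (real B) / 10"
        using KL B 2 L \<epsilon> y by (intro divide_right_mono mult_mono) auto
      also have "\<dots> \<le> real m"
        using K B by (intro mem_ge) (auto simp: K_def B_def)
      finally show ?thesis .
    next
      case 3
      \<comment> \<open>One level of \<open>k\<close> items suffices: \<open>L < 1\<close>, and
        \<open>L * log 2 (1 / L)\<close> adds at most 2, which the factor 4 inside the logarithm
        absorbs.\<close>
      define B where "B = U div k"
      have "4 * (\<epsilon> * real U) * real k = (4 * \<epsilon> * real k) * real U" by simp
      also have "\<dots> \<le> 1 * real U" by (intro mult_right_mono k\<epsilon>) simp
      finally have "4 * (\<epsilon> * real U) \<le> real U / real k" using k by (simp add: field_simps)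
      moreover have "real U / real k < real B + 1"
        unfolding B_def using floor_divide_of_nat_eq[of U k, where ?'a = real]
        by linarith
      ultimately have B: "3 * (\<epsilon> * real U) \<le> real B" "2 \<le> B" using 3 by linarith+
      have "L * log 2 y = L * log 2 (\<epsilon> * real U) + L * log 2 (1 / L)"
        using L \<epsilon> U by (simp add: y_def log_divide algebra_simps)
      also have "\<dots> \<le> 1 * log 2 (\<epsilon> * real U) + L * (2 * (1 / L))"
        using L 3 by (intro add_mono mult_right_mono mult_left_mono log2_le_twice) auto
      also have "\<dots> = log 2 (4 * (\<epsilon> * real U))"
        using 3 L \<epsilon> U log_mult[of 2 4 "\<epsilon> * real U"] log_pow_cancel[of 2 2] by simp
      also have "\<dots> \<le> log 2 (real B ^ 2)"
      proof -
        have "4 * (\<epsilon> * real U) \<le> 9 * (\<epsilon> * real U) * (\<epsilon> * real U)"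
          using 3 mult_left_mono[of 1 "\<epsilon> * real U" "9 * (\<epsilon> * real U)"] by linarith
        also have "\<dots> = (3 * (\<epsilon> * real U)) ^ 2" by (simp add: power2_eq_square)
        also have "\<dots> \<le> real B ^ 2" using B 3 by (intro power_mono) auto
        finally show ?thesis using 3 B by simp
      qed
      also have "\<dots> = 2 * log 2 (real B)" using B by (simp add: log_nat_power)
      finally have "L * log 2 y / (160 * \<epsilon>) \<le> 2 * log 2 (real B) / (160 * \<epsilon>)"
        using \<epsilon> by (intro divide_right_mono) auto
      also have "\<dots> = 1 / (8 * \<epsilon>) * log 2 (real B) / 10" by simp
      also have "\<dots> \<le> real k * log 2 (real B) / 10"
        using k_ge B by (intro divide_right_mono mult_right_mono) auto
      also have "\<dots> \<le> real m"
        using k J B by (intro mem_ge) (auto simp: B_def)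
      finally show ?thesis .
    next
      case 4
      \<comment> \<open>Here \<open>L * log 2 y \<le> 2 * \<epsilon> * U\<close>, so a bound of
        order \<open>U\<close> is enough: chunks of two elements, as many as \<open>k\<close> and
        \<open>U\<close> allow.\<close>
      define K where "K = min k (U div 2)"
      have KJ: "K \<le> J * k" using J by (simp add: K_def min.coboundedI1)
      have "real U / 8 \<le> 1 / (8 * \<epsilon>)" using 4 \<epsilon> by (simp add: field_simps)
      then have "real U / 8 \<le> real k" using k_ge by linarith
      moreover have "real U / 8 \<le> real (U div 2)" using U by linarith
      ultimately have "real U / 8 \<le> real K" by (simp add: K_def)
      have "L * log 2 y \<le> L * (2 * y)"
        using L y by (intro mult_left_mono log2_le_twice) auto
      also have "\<dots> = 2 * (\<epsilon> * real U)" using L by (simp add: y_def)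
      finally have "L * log 2 y / (160 * \<epsilon>) \<le> 2 * (\<epsilon> * real U) / (160 * \<epsilon>)"
        using \<epsilon> by (intro divide_right_mono) auto
      also have "\<dots> = real U / 8 / 10" using \<epsilon> by simp
      also have "\<dots> \<le> real K * log 2 (real 2) / 10"
        using \<open>real U / 8 \<le> real K\<close> by simp
      also have "\<dots> \<le> real m"
        using k U KJ by (intro mem_ge) (auto simp: K_def)
      finally show ?thesis .
    qed
  qed
  then show "1 / 160 * (1 / \<epsilon> * log 2 (\<epsilon> * real n)
      * log 2 (\<epsilon> * real U / log 2 (\<epsilon> * real n))) \<le> real m"
    by (simp add: L_def y_def)
qed

end
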